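(* Let $f,g:\mathbb{R}\to\mathbb{R}$ be continuously differentiable functions, with $f''$ existing and continuous. Let $p\in\mathbb{R}$ be an isolated zero of $f$ such that $f'(p)\neq 0$, and suppose that $g$ has an isolated zero at the origin (that is, $g(0)=0$ and $g$ does not vanish at any other point of some neighborhood of $0$). Let $(x_n)_{n\ge 0}$ be a well-defined sequence produced by the $g$-Steffensen iteration $$x_{n+1}=x_n-\frac{g(f(x_n))\, f(x_n)}{f\bigl(x_n+g(f(x_n))\bigr)-f(x_n)},\qquad n\ge 0,$$ (with the convention that $x_{n+1}=p$ if $x_n=p$), and suppose that $(x_n)$ converges to $p$. Then the rate of convergence is quadratic: there exist a constant $C\ge 0$ and an index $N$ such that $|x_{n+1}-p|\le C\,|x_n-p|^2$ for all $n\ge N$.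
   Context: The $g$-Steffensen method for solving $f(x)=0$ is the iteration displayed in the claim; the choice $g(x)=x$ gives the classical Steffensen method. At $x_n=p$ the displayed quotient has the form $0/0$; the convention is that the iteration map fixes $p$, i.e. $x_{n+1}=p$ whenever $x_n=p$. "Quadratic rate of convergence" means convergence of order (at least) two, as spelled out in the claim. *)

theory Defs
  imports "HOL-Analysis.Analysis"
begin

text \<open>
  The library notion in \<^verbatim>\<open>HOL-Complex_Analysis\<close> (limit \<open>0\<close> at the point) does not constrain the
  value at the point itself; here the function is required to vanish there.
\<close>

definition isolated_root :: "(real \<Rightarrow> real) \<Rightarrow> real \<Rightarrow> bool" where
  "isolated_root f p \<longleftrightarrow> f p = 0 \<and> (\<forall>\<^sub>F x in at p. f x \<noteq> 0)"

definition steffensen_denom :: "(real \<Rightarrow> real) \<Rightarrow> (real \<Rightarrow> real) \<Rightarrow> real \<Rightarrow> real" where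
  "steffensen_denom g f x = f (x + g (f x)) - f x"

definition steffensen_map :: "(real \<Rightarrow> real) \<Rightarrow> (real \<Rightarrow> real) \<Rightarrow> real \<Rightarrow> real \<Rightarrow> real" where
  "steffensen_map g f p x =
     (if x = p then p else x - g (f x) * f x / steffensen_denom g f x)"

text \<open>
  Well-definedness is explicit because division by zero yields \<open>0\<close> in HOL: every iterate other than
  \<open>p\<close> must have a nonzero denominator.
\<close>

definition steffensen_sequence ::
    "(real \<Rightarrow> real) \<Rightarrow> (real \<Rightarrow> real) \<Rightarrow> real \<Rightarrow> (nat \<Rightarrow> real) \<Rightarrow> bool" where
  "steffensen_sequence g f p x \<longleftrightarrow>
     (\<forall>n. (x n \<noteq> p \<longrightarrow> steffensen_denom g f (x n) \<noteq> 0) \<and>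
          x (Suc n) = steffensen_map g f p (x n))"

end

theory Submission
  imports Defs
begin

text \<open>
  Write \<open>h = g (f x)\<close>. Two applications of the mean value theorem linearise the Steffensen quotient:
  \<open>f x = (x - p) * f' \<eta>\<close> with \<open>\<eta>\<close> between \<open>p\<close> and \<open>x\<close>, and \<open>f (x + h) - f x = h * f' \<xi>\<close> with
  \<open>\<xi>\<close> between \<open>x\<close> and \<open>x + h\<close>. The factor \<open>h\<close> cancels (it is nonzero because the denominator is), so
  the error after one step is
  \<open>(x - p) * (f' \<xi> - f' \<eta>) / f' \<xi>\<close>.

  Since \<open>f p = 0\<close> and \<open>g 0 = 0\<close>, local Lipschitz bounds for \<open>f\<close> and \<open>g\<close> make \<open>h\<close> of order \<open>x - p\<close>,
  hence \<open>\<xi>\<close> and \<open>\<eta>\<close> are within a multiple of \<open>\<bar>x - p\<bar>\<close> of each other. As \<open>f'\<close> is itself locally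
  Lipschitz, \<open>f' \<xi> - f' \<eta>\<close> is of order \<open>x - p\<close> as well, while \<open>f' \<xi>\<close> stays away from \<open>0\<close> because
  \<open>f' p \<noteq> 0\<close>. This yields the second factor \<open>\<bar>x - p\<bar>\<close>, in
  \<open>steffensen_map_locally_quadratic\<close>; the claim on the sequence then follows because its tail lies in
  the neighbourhood where this estimate holds.
\<close>

lemma C1_imp_DERIV_deriv:
  fixes u :: "real \<Rightarrow> real"
  assumes "u C1_differentiable_on UNIV"
  shows "(u has_real_derivative deriv u y) (at y)"
proof -
  obtain D where "(u has_vector_derivative D y) (at y)"
    using assms unfolding C1_differentiable_on_def by blast
  then show ?thesis
    by (metis DERIV_imp_deriv has_real_derivative_iff_has_vector_derivative)
qed

text \<open>The derivative is continuous, hence bounded on a compact interval.\<close>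

lemma C1_imp_lipschitz_on_cball:
  fixes u :: "real \<Rightarrow> real"
  assumes "u C1_differentiable_on UNIV"
  obtains L where "L-lipschitz_on (cball c r) u"
proof -
  obtain D where D: "\<And>y. (u has_vector_derivative D y) (at y)" and "continuous_on UNIV D"
    using assms unfolding C1_differentiable_on_def by blast
  then have "bounded (D ` cball c r)"
    by (intro compact_imp_bounded compact_continuous_image)
      (auto intro: continuous_on_subset)
  then obtain B where B: "B > 0" "\<And>y. y \<in> cball c r \<Longrightarrow> \<bar>D y\<bar> \<le> B"
    by (auto simp: bounded_pos)
  have "B-lipschitz_on (cball c r) u"
  proof (rule bounded_derivative_imp_lipschitz[where f' = "\<lambda>y t. t *\<^sub>R D y"])
    show "(u has_derivative (\<lambda>t. t *\<^sub>R D y)) (at y within cball c r)" for y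
      using D by (auto simp: has_vector_derivative_def intro: has_derivative_at_withinI)
    show "onorm (\<lambda>t. t *\<^sub>R D y) \<le> B" if "y \<in> cball c r" for y
      using B(2)[OF that] B(1)
      by (intro onorm_bound) (auto simp: abs_mult mult.commute[of B] intro: mult_left_mono)
  qed (use B in auto)
  then show ?thesis by (rule that)
qed

text \<open>
  A form of the mean value theorem without an order on the end points, which is needed because
  neither \<open>x - p\<close> nor \<open>g (f x)\<close> has a known sign.
\<close>

lemma mean_value_unordered:
  fixes u :: "real \<Rightarrow> real"
  assumes "\<And>y. (u has_real_derivative u' y) (at y)"
  obtains z where "\<bar>z - a\<bar> \<le> \<bar>b - a\<bar>" and "\<bar>z - b\<bar> \<le> \<bar>b - a\<bar>" and "u b - u a = (b - a) * u' z"
proof (cases a b rule: linorder_cases)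
  case less
  then obtain z where "a < z" "z < b" "u b - u a = (b - a) * u' z"
    using MVT2[of a b u u'] assms by blast
  then show ?thesis by (intro that[of z]) auto
next
  case equal
  then show ?thesis by (intro that[of a]) auto
next
  case greater
  then obtain z where "b < z" "z < a" "u a - u b = (a - b) * u' z"
    using MVT2[of b a u u'] assms by blast
  then show ?thesis by (intro that[of z]) (auto simp: algebra_simps)
qed

lemma steffensen_map_error_eq:
  assumes "x \<noteq> p" and "steffensen_denom g f x \<noteq> 0"
    and num: "f x = (x - p) * a"
    and den: "steffensen_denom g f x = g (f x) * b"
  shows "steffensen_map g f p x - p = (x - p) * (b - a) / b"
proof -
  have nz: "g (f x) \<noteq> 0" "b \<noteq> 0"
    using assms(2) den by auto
  have "steffensen_map g f p x - p = (x - p) - g (f x) * f x / (g (f x) * b)"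
    using assms(1) den by (simp add: steffensen_map_def)
  also have "\<dots> = (x - p) - (x - p) * a / b"
    using nz num by simp
  also have "\<dots> = (x - p) * (b - a) / b"
    using nz by (simp add: field_simps)
  finally show ?thesis .
qed

text \<open>
  The whole analytic content: near a simple zero one step squares the error, up to a constant. The
  condition on the denominator cannot be dropped, since at a point where it vanishes the step
  degenerates to the identity (everywhere, if \<open>g\<close> vanishes identically).
\<close>

lemma steffensen_map_locally_quadratic:
  fixes f g :: "real \<Rightarrow> real"
  assumes f: "f C1_differentiable_on UNIV"
    and f': "deriv f C1_differentiable_on UNIV"
    and g: "g C1_differentiable_on UNIV"
    and "f p = 0" and "g 0 = 0" and simple: "deriv f p \<noteq> 0"
  obtains C where "C \<ge> 0"
    and "\<forall>\<^sub>F x in nhds p. (x \<noteq> p \<longrightarrow> steffensen_denom g f x \<noteq> 0) \<longrightarrow>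
           \<bar>steffensen_map g f p x - p\<bar> \<le> C * \<bar>x - p\<bar>\<^sup>2"
proof -
  obtain M where M: "M-lipschitz_on (cball p 1) f"
    using C1_imp_lipschitz_on_cball[OF f] .
  obtain L where L: "L-lipschitz_on (cball 0 1) g"
    using C1_imp_lipschitz_on_cball[OF g] .
  obtain K where K: "K-lipschitz_on (cball p 1) (deriv f)"
    using C1_imp_lipschitz_on_cball[OF f'] .
  note nonneg = lipschitz_on_nonneg[OF M] lipschitz_on_nonneg[OF L] lipschitz_on_nonneg[OF K]
  note mvt = mean_value_unordered[OF C1_imp_DERIV_deriv[OF f]]
  \<comment> \<open>\<open>A * \<bar>x - p\<bar>\<close> bounds \<open>\<bar>x - p\<bar> + \<bar>g (f x)\<bar>\<close>, and so the distance of \<open>\<xi>\<close>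
    from both \<open>p\<close> and \<open>\<eta>\<close>.\<close>
  define A where "A = 1 + L * M"
  define d where "d = \<bar>deriv f p\<bar>"
  have "A \<ge> 1" "d > 0"
    using nonneg simple by (auto simp: A_def d_def)
  have small: "\<forall>\<^sub>F x in nhds p. B * \<bar>x - p\<bar> < e" if "e > 0" for B e :: real
  proof -
    have "((\<lambda>x. B * \<bar>x - p\<bar>) \<longlongrightarrow> B * \<bar>p - p\<bar>) (nhds p)"
      by (intro tendsto_intros) (rule filterlim_ident)
    then show ?thesis
      using that by (auto dest: order_tendstoD(2))
  qed
  have step: "\<bar>steffensen_map g f p x - p\<bar> \<le> (2 * K * A / d) * \<bar>x - p\<bar>\<^sup>2"
    if A1: "A * \<bar>x - p\<bar> < 1" and M1: "M * \<bar>x - p\<bar> < 1" and K1: "(K * A) * \<bar>x - p\<bar> < d / 2"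
      and wd: "x \<noteq> p \<longrightarrow> steffensen_denom g f x \<noteq> 0" for x
  proof (cases "x = p")
    case True
    then show ?thesis by (simp add: steffensen_map_def)
  next
    case False
    define h where "h = g (f x)"
    have "1 * \<bar>x - p\<bar> \<le> A * \<bar>x - p\<bar>"
      using \<open>A \<ge> 1\<close> by (intro mult_right_mono) auto
    with A1 have x1: "\<bar>x - p\<bar> \<le> 1" by simp
    have fx: "\<bar>f x\<bar> \<le> M * \<bar>x - p\<bar>"
      using lipschitz_onD[OF M, of x p] x1 \<open>f p = 0\<close> by (simp add: dist_real_def abs_minus_commute)
    have "\<bar>h\<bar> \<le> L * \<bar>f x\<bar>"
      using lipschitz_onD[OF L, of "f x" 0] fx M1 \<open>g 0 = 0\<close> by (simp add: dist_real_def h_def)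
    also have "\<dots> \<le> L * (M * \<bar>x - p\<bar>)"
      using fx nonneg by (intro mult_left_mono)
    finally have hA: "\<bar>x - p\<bar> + \<bar>h\<bar> \<le> A * \<bar>x - p\<bar>"
      by (simp add: A_def algebra_simps)
    obtain \<eta> where \<eta>: "\<bar>\<eta> - p\<bar> \<le> \<bar>x - p\<bar>" "\<bar>\<eta> - x\<bar> \<le> \<bar>x - p\<bar>"
        and num: "f x - f p = (x - p) * deriv f \<eta>"
      by (rule mvt[where a = p and b = x])
    obtain \<xi> where \<xi>: "\<bar>\<xi> - x\<bar> \<le> \<bar>x + h - x\<bar>"
        and den: "f (x + h) - f x = (x + h - x) * deriv f \<xi>"
      by (rule mvt[where a = x and b = "x + h"])
    have close: "\<bar>\<xi> - p\<bar> \<le> A * \<bar>x - p\<bar>" "\<bar>\<xi> - \<eta>\<bar> \<le> A * \<bar>x - p\<bar>"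
      using \<eta> \<xi> hA by linarith+
    have K_mono: "K * t \<le> K * A * \<bar>x - p\<bar>" if "t \<le> A * \<bar>x - p\<bar>" for t
      using mult_left_mono[OF that nonneg(3)] by (simp add: mult.assoc)
    have "\<bar>deriv f \<xi> - deriv f \<eta>\<bar> \<le> K * \<bar>\<xi> - \<eta>\<bar>"
      using lipschitz_onD[OF K, of \<xi> \<eta>] close A1 \<eta> x1
      by (simp add: dist_real_def abs_minus_commute)
    also have "\<dots> \<le> K * A * \<bar>x - p\<bar>"
      using close K_mono by blast
    finally have diff: "\<bar>deriv f \<xi> - deriv f \<eta>\<bar> \<le> K * A * \<bar>x - p\<bar>" .
    have "\<bar>deriv f \<xi> - deriv f p\<bar> \<le> K * \<bar>\<xi> - p\<bar>"
      using lipschitz_onD[OF K, of \<xi> p] close A1 by (simp add: dist_real_def abs_minus_commute)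
    also have "\<dots> \<le> K * A * \<bar>x - p\<bar>"
      using close K_mono by blast
    finally have away: "d / 2 \<le> \<bar>deriv f \<xi>\<bar>"
      using K1 unfolding d_def by linarith
    have "steffensen_map g f p x - p = (x - p) * (deriv f \<xi> - deriv f \<eta>) / deriv f \<xi>"
      using False wd num den \<open>f p = 0\<close>
      by (intro steffensen_map_error_eq) (auto simp: steffensen_denom_def h_def)
    then have "\<bar>steffensen_map g f p x - p\<bar> =
        \<bar>x - p\<bar> * \<bar>deriv f \<xi> - deriv f \<eta>\<bar> / \<bar>deriv f \<xi>\<bar>"
      by (simp add: abs_mult)
    also have "\<dots> \<le> \<bar>x - p\<bar> * (K * A * \<bar>x - p\<bar>) / (d / 2)"
      using diff away \<open>d > 0\<close> by (intro frac_le mult_left_mono) auto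
    also have "\<dots> = (2 * K * A / d) * \<bar>x - p\<bar>\<^sup>2"
      by (simp add: power2_eq_square)
    finally show ?thesis .
  qed
  show ?thesis
  proof (rule that)
    show "2 * K * A / d \<ge> 0"
      using nonneg \<open>A \<ge> 1\<close> \<open>d > 0\<close> by simp
    have "\<forall>\<^sub>F x in nhds p. A * \<bar>x - p\<bar> < 1" "\<forall>\<^sub>F x in nhds p. M * \<bar>x - p\<bar> < 1"
         "\<forall>\<^sub>F x in nhds p. (K * A) * \<bar>x - p\<bar> < d / 2"
      using \<open>d > 0\<close> by (auto intro!: small simp del: less_divide_eq_numeral1)
    then show "\<forall>\<^sub>F x in nhds p. (x \<noteq> p \<longrightarrow> steffensen_denom g f x \<noteq> 0) \<longrightarrow>
        \<bar>steffensen_map g f p x - p\<bar> \<le> (2 * K * A / d) * \<bar>x - p\<bar>\<^sup>2"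
      by eventually_elim (use step in blast)
  qed
qed

theorem theorem3p2:
  fixes f g :: "real \<Rightarrow> real" and p :: real and x :: "nat \<Rightarrow> real"
  assumes "f C1_differentiable_on UNIV"
    and "deriv f C1_differentiable_on UNIV"
    and "g C1_differentiable_on UNIV"
    and "isolated_root f p"
    and "deriv f p \<noteq> 0"
    and "isolated_root g 0"
    and "steffensen_sequence g f p x"
    and "x \<longlonglongrightarrow> p"
  shows "\<exists>C\<ge>0. \<exists>N. \<forall>n\<ge>N. \<bar>x (Suc n) - p\<bar> \<le> C * \<bar>x n - p\<bar>\<^sup>2"
proof -
  have roots: "f p = 0" "g 0 = 0"
    using assms(4,6) by (simp_all add: isolated_root_def)
  obtain C where "C \<ge> 0"
    and "\<forall>\<^sub>F y in nhds p. (y \<noteq> p \<longrightarrow> steffensen_denom g f y \<noteq> 0) \<longrightarrow>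
           \<bar>steffensen_map g f p y - p\<bar> \<le> C * \<bar>y - p\<bar>\<^sup>2"
    using steffensen_map_locally_quadratic[OF assms(1-3) roots assms(5)] .
  then have "\<forall>\<^sub>F n in sequentially. (x n \<noteq> p \<longrightarrow> steffensen_denom g f (x n) \<noteq> 0) \<longrightarrow>
      \<bar>steffensen_map g f p (x n) - p\<bar> \<le> C * \<bar>x n - p\<bar>\<^sup>2"
    using assms(8) by (intro eventually_compose_filterlim[where f = x and F = "nhds p"])
  then have "\<forall>\<^sub>F n in sequentially. \<bar>x (Suc n) - p\<bar> \<le> C * \<bar>x n - p\<bar>\<^sup>2"
    using assms(7) by (simp add: steffensen_sequence_def)
  with \<open>C \<ge> 0\<close> show ?thesis
    by (auto simp: eventually_sequentially)
qed

end
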